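(* Let $A\in\mathbb{R}^{m\times n}$ ($m\le n$) have full row rank $m$, let $b\in\mathbb{R}^m$, $c\in\mathbb{R}^n$, and assume that (PD) has a unique and nondegenerate primal solution $x^*$. Then there exists a positive scalar $\hat\lambda=\hat\lambda(A,b,c,x^* )$ such that for every $\lambda\in\mathbb{R}^n$ with $\lambda\ge0$ and $0\le\|\lambda\|<\hat\lambda$, the pair of perturbed problems (PD$_\lambda$) has a strictly complementary solution $(x^*_\lambda,y^*_\lambda,s^*_\lambda)$ with the same active and inactive sets as $x^*$.
   Context: Vector inequalities are componentwise; $\|\cdot\|$ is the Euclidean norm. (PD) is the primal-dual pair of linear programs: minimize $c^Tx$ subject to $Ax=b$, $x\ge 0$; and maximize $b^Ty$ subject to $A^Ty+s=c$, $s\ge0$. A primal solution $x^*$ is nondegenerate if it is a basic feasible solution with exactly $m$ positive components. The active set of $x^*$ is $\{i: x^*_i=0\}$ and its inactive set is the complement $\{i:x^*_i>0\}$. For $\lambda\ge0$, (PD$_\lambda$) is the perturbed pair: minimize $(c+\lambda)^T(x+\lambda)$ subject to $Ax=b$, $x\ge-\lambda$; and maximize $(b+A\lambda)^Ty$ subject to $A^Ty+s=c$, $s\ge-\lambda$. A triple $(x_\lambda^*,y_\lambda^*,s_\lambda^* )$ is a solution of (PD$_\lambda$) iff $Ax=b$, $A^Ty+s=c$, $(x_i+\lambda_i)(s_i+\lambda_i)=0$ for all $i$, and $x+\lambda\ge0$, $s+\lambda\ge0$. It is strictly complementary if moreover $(x^*_\lambda+\lambda)+(s^*_\lambda+\lambda)>0$.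 Its active set is $\{i:(x^*_\lambda)_i+\lambda_i=0\}$ and its inactive set is $\{i:(s^*_\lambda)_i+\lambda_i=0\}$. *)

theory Defs
  imports "HOL-Analysis.Analysis"
begin

text \<open>The order on \<^typ>\<open>real^'n\<close> used here is the library's componentwise order. Its strict part
  is not componentwise strict inequality, so strict inequalities are written out by components.\<close>

definition primal_feasible :: "real^'n^'m \<Rightarrow> real^'m \<Rightarrow> real^'n \<Rightarrow> bool" where
  "primal_feasible A b x \<longleftrightarrow> A *v x = b \<and> 0 \<le> x"

definition primal_solution :: "real^'n^'m \<Rightarrow> real^'m \<Rightarrow> real^'n \<Rightarrow> real^'n \<Rightarrow> bool" where
  "primal_solution A b c x \<longleftrightarrow>
     primal_feasible A b x \<and> (\<forall>x'. primal_feasible A b x' \<longrightarrow> c \<bullet> x \<le> c \<bullet> x')"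

text \<open>Injectivity makes the columns indexed by \<open>B\<close> independent as a family: without it,
  two equal columns would count as one element of the set of columns.\<close>

definition column_basis :: "real^'n^'m \<Rightarrow> 'n set \<Rightarrow> bool" where
  "column_basis A B \<longleftrightarrow>
     card B = CARD('m) \<and> inj_on (\<lambda>j. column j A) B \<and> independent ((\<lambda>j. column j A) ` B)"

definition basic_feasible_solution :: "real^'n^'m \<Rightarrow> real^'m \<Rightarrow> real^'n \<Rightarrow> bool" where
  "basic_feasible_solution A b x \<longleftrightarrow>
     primal_feasible A b x \<and> (\<exists>B. column_basis A B \<and> (\<forall>i. i \<notin> B \<longrightarrow> x $ i = 0))"

definition nondegenerate :: "real^'n^'m \<Rightarrow> real^'m \<Rightarrow> real^'n \<Rightarrow> bool" where
  "nondegenerate A b x \<longleftrightarrow>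
     basic_feasible_solution A b x \<and> card {i. x $ i > 0} = CARD('m)"

definition active_set :: "real^'n \<Rightarrow> 'n set" where
  "active_set x = {i. x $ i = 0}"

definition inactive_set :: "real^'n \<Rightarrow> 'n set" where
  "inactive_set x = {i. x $ i > 0}"

definition perturbed_primal_feasible ::
    "real^'n^'m \<Rightarrow> real^'m \<Rightarrow> real^'n \<Rightarrow> real^'n \<Rightarrow> bool" where
  "perturbed_primal_feasible A b l x \<longleftrightarrow> A *v x = b \<and> - l \<le> x"

definition perturbed_dual_feasible ::
    "real^'n^'m \<Rightarrow> real^'n \<Rightarrow> real^'n \<Rightarrow> real^'m \<Rightarrow> real^'n \<Rightarrow> bool" where
  "perturbed_dual_feasible A c l y s \<longleftrightarrow> transpose A *v y + s = c \<and> - l \<le> s"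

definition perturbed_primal_optimal ::
    "real^'n^'m \<Rightarrow> real^'m \<Rightarrow> real^'n \<Rightarrow> real^'n \<Rightarrow> real^'n \<Rightarrow> bool" where
  "perturbed_primal_optimal A b c l x \<longleftrightarrow>
     perturbed_primal_feasible A b l x \<and>
     (\<forall>x'. perturbed_primal_feasible A b l x' \<longrightarrow> (c + l) \<bullet> (x + l) \<le> (c + l) \<bullet> (x' + l))"

definition perturbed_dual_optimal ::
    "real^'n^'m \<Rightarrow> real^'m \<Rightarrow> real^'n \<Rightarrow> real^'n \<Rightarrow> real^'m \<Rightarrow> real^'n \<Rightarrow> bool" where
  "perturbed_dual_optimal A b c l y s \<longleftrightarrow>
     perturbed_dual_feasible A c l y s \<and>
     (\<forall>y' s'. perturbed_dual_feasible A c l y' s' \<longrightarrow> (b + A *v l) \<bullet> y' \<le> (b + A *v l) \<bullet> y)"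

text \<open>Solutions of the perturbed pair are given by the optimality conditions;
  \<open>perturbed_solution_optimal\<close> below shows that they are optimal for both linear programs.\<close>

definition perturbed_solution ::
    "real^'n^'m \<Rightarrow> real^'m \<Rightarrow> real^'n \<Rightarrow> real^'n \<Rightarrow> real^'n \<Rightarrow> real^'m \<Rightarrow> real^'n \<Rightarrow> bool" where
  "perturbed_solution A b c l x y s \<longleftrightarrow>
     A *v x = b \<and> transpose A *v y + s = c \<and>
     (\<forall>i. (x $ i + l $ i) * (s $ i + l $ i) = 0) \<and>
     0 \<le> x + l \<and> 0 \<le> s + l"

definition strictly_complementary_solution ::
    "real^'n^'m \<Rightarrow> real^'m \<Rightarrow> real^'n \<Rightarrow> real^'n \<Rightarrow> real^'n \<Rightarrow> real^'m \<Rightarrow> real^'n \<Rightarrow> bool" where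
  "strictly_complementary_solution A b c l x y s \<longleftrightarrow>
     perturbed_solution A b c l x y s \<and>
     (\<forall>i. (x $ i + l $ i) + (s $ i + l $ i) > 0)"

definition perturbed_active_set :: "real^'n \<Rightarrow> real^'n \<Rightarrow> 'n set" where
  "perturbed_active_set l x = {i. x $ i + l $ i = 0}"

text \<open>Unlike \<^const>\<open>perturbed_active_set\<close>, this is a set of zeros of the shifted dual slack.\<close>

definition perturbed_inactive_set :: "real^'n \<Rightarrow> real^'n \<Rightarrow> 'n set" where
  "perturbed_inactive_set l s = {i. s $ i + l $ i = 0}"

lemma perturbed_duality_gap:
  fixes A :: "real^'n^'m"
  assumes "A *v x = b" "transpose A *v y + s = c"
  shows "(c + l) \<bullet> (x + l) = (b + A *v l) \<bullet> y + (s + l) \<bullet> (x + l)"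
proof -
  have "(transpose A *v y) \<bullet> (x + l) = y \<bullet> (A *v (x + l))"
    by (simp add: dot_lmul_matrix)
  also have "\<dots> = (b + A *v l) \<bullet> y"
    by (simp add: matrix_vector_right_distrib inner_commute assms(1))
  finally have "(transpose A *v y) \<bullet> (x + l) = (b + A *v l) \<bullet> y" .
  moreover have "c + l = transpose A *v y + (s + l)"
    using assms(2) by (simp add: add.assoc)
  ultimately show ?thesis
    by (simp only: inner_add_left[of "transpose A *v y" "s + l"])
qed

lemma perturbed_gap_nonneg:
  fixes s x l :: "real^'n"
  assumes "- l \<le> x" "- l \<le> s"
  shows "0 \<le> (s + l) \<bullet> (x + l)"
proof -
  have "0 \<le> s $ i + l $ i" "0 \<le> x $ i + l $ i" for i
    using assms by (simp_all add: less_eq_vec_def) (metis diff_ge_0_iff_ge diff_minus_eq_add)+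
  then show ?thesis
    by (simp add: inner_vec_def sum_nonneg)
qed

lemma perturbed_solution_optimal:
  assumes "perturbed_solution A b c l x y s"
  shows "perturbed_primal_optimal A b c l x \<and> perturbed_dual_optimal A b c l y s"
proof -
  have eqs: "A *v x = b" "transpose A *v y + s = c"
    using assms by (simp_all add: perturbed_solution_def)
  have "0 \<le> x $ i + l $ i" "0 \<le> s $ i + l $ i" for i
    using assms by (simp_all add: perturbed_solution_def less_eq_vec_def)
  then have ge: "- l \<le> x" "- l \<le> s"
    by (simp_all add: less_eq_vec_def) (metis diff_ge_0_iff_ge diff_minus_eq_add)+
  have z: "(s + l) \<bullet> (x + l) = 0"
    using assms
    by (auto simp: perturbed_solution_def inner_vec_def mult.commute intro!: sum.neutral)
  have gap: "(c + l) \<bullet> (x + l) = (b + A *v l) \<bullet> y"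
    using perturbed_duality_gap[OF eqs, of l] z by simp
  have weak: "(b + A *v l) \<bullet> y' \<le> (c + l) \<bullet> (x' + l)"
    if "perturbed_primal_feasible A b l x'" "perturbed_dual_feasible A c l y' s'" for x' y' s'
    using that perturbed_duality_gap[of A x' b y' s' c l] perturbed_gap_nonneg[of l x' s']
    by (simp add: perturbed_primal_feasible_def perturbed_dual_feasible_def)
  have fp: "perturbed_primal_feasible A b l x" and fd: "perturbed_dual_feasible A c l y s"
    using eqs ge by (simp_all add: perturbed_primal_feasible_def perturbed_dual_feasible_def)
  show ?thesis
    using fp fd weak[OF _ fd] weak[OF fp]
    unfolding perturbed_primal_optimal_def perturbed_dual_optimal_def
    by (simp add: gap)
qed

end

theory Submission
  imports Defs
begin

text \<open>Let \<open>B\<close> be the support of the unique solution \<open>x*\<close>. By nondegeneracy the columns of \<open>A\<close> in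
  \<open>B\<close> form a basis of \<open>\<real>\<^sup>m\<close>, so \<open>A\<close> has a right inverse \<open>R\<close> with values supported on \<open>B\<close>
  (\<open>column_basis_right_inverse\<close>), and \<open>P = R A\<close> is the projection along the kernel of \<open>A\<close> onto the
  vectors supported on \<open>B\<close>. The strictly complementary solution is then explicit:
  \<open>x + \<lambda> = x* + P \<lambda>\<close>, \<open>y = R\<^sup>T (c + \<lambda>)\<close> and \<open>s + \<lambda> = (c + \<lambda>) - P\<^sup>T (c + \<lambda>)\<close>. The equations hold
  because \<open>A P = A\<close> and \<open>A\<^sup>T R\<^sup>T = P\<^sup>T\<close>, and for every \<open>\<lambda>\<close> the first vector vanishes off \<open>B\<close>, the
  second on \<open>B\<close>.

  It remains to have \<open>x + \<lambda>\<close> positive on \<open>B\<close> and \<open>s + \<lambda>\<close> positive off \<open>B\<close>. Both vectors are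
  continuous in \<open>\<lambda>\<close>, so it suffices that they are positive there for \<open>\<lambda> = 0\<close>. For \<open>x*\<close> this is the
  choice of \<open>B\<close>; for the reduced costs \<open>c - P\<^sup>T c\<close> it is where uniqueness enters: were some
  reduced cost nonpositive, moving \<open>x*\<close> along the corresponding edge of the feasible polyhedron would
  not increase the cost and would reach another solution (\<open>unique_solution_reduced_cost_pos\<close>).\<close>

text \<open>The matrix \<open>R\<close> is the inverse of the square submatrix of basic columns, padded with zero rows.
  It arises as a left inverse of \<open>A\<close> on the subspace of vectors supported on \<open>B\<close>, where \<open>A\<close> is
  injective because the basic columns are independent and onto because they span.\<close>

lemma column_basis_right_inverse:
  fixes A :: "real^'n^'m"
  assumes "column_basis A B"
  obtains R :: "real^'m^'n" where
    "A ** R = mat 1"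
    "\<And>w i. i \<notin> B \<Longrightarrow> (R *v w) $ i = 0"
    "\<And>v. (\<And>i. i \<notin> B \<Longrightarrow> v $ i = 0) \<Longrightarrow> R *v (A *v v) = v"
proof -
  let ?col = "\<lambda>j. column j A"
  define S where "S = {v :: real^'n. \<forall>i. i \<notin> B \<longrightarrow> v $ i = 0}"
  have card: "card B = CARD('m)" and inj: "inj_on ?col B" and ind: "independent (?col ` B)"
    using assms by (auto simp: column_basis_def)
  have S: "subspace S"
    by (auto simp: S_def subspace_def)
  have lin: "linear ((*v) A)"
    by simp
  have zero: "v = 0" if v: "v \<in> S" "A *v v = 0" for v
  proof -
    \<comment> \<open>Independence speaks of a set of vectors, so the coefficients are carried over from
      the indices to the columns.\<close>
    have "(\<Sum>w\<in>?col ` B. v $ (inv_into B ?col w) *\<^sub>R w) = (\<Sum>j\<in>B. v $ j *\<^sub>R ?col j)"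
      by (simp add: sum.reindex[OF inj] inv_into_f_f[OF inj] cong: sum.cong)
    also have "\<dots> = (\<Sum>j\<in>UNIV. v $ j *\<^sub>R ?col j)"
      using v(1) by (intro sum.mono_neutral_left) (auto simp: S_def)
    also have "\<dots> = 0"
      using v(2) by (simp add: matrix_mult_sum scalar_mult_eq_scaleR)
    finally have sum0: "(\<Sum>w\<in>?col ` B. v $ (inv_into B ?col w) *\<^sub>R w) = 0" .
    have "v $ j = 0" if "j \<in> B" for j
      using independentD[OF ind _ subset_refl sum0, of "?col j"] that
        inv_into_f_f[OF inj that] by simp
    then show ?thesis
      using v(1) by (auto simp: S_def vec_eq_iff)
  qed
  have injS: "inj_on ((*v) A) S"
    using linear_injective_on_subspace_0[OF lin S] zero by blast
  have surj: "(*v) A ` S = UNIV"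
  proof -
    have "?col j \<in> (*v) A ` S" if "j \<in> B" for j
      using that by (intro image_eqI[of _ _ "axis j 1"])
        (auto simp: S_def axis_def matrix_vector_mult_basis[unfolded axis_def])
    then have "span (?col ` B) \<subseteq> (*v) A ` S"
      by (intro span_minimal linear_subspace_image[OF lin S]) auto
    moreover have "UNIV \<subseteq> span (?col ` B)"
      using ind card inj by (intro card_ge_dim_independent) (auto simp: card_image)
    ultimately show ?thesis by blast
  qed
  obtain g where g: "range g \<subseteq> S" "linear g" "\<And>v. v \<in> S \<Longrightarrow> g (A *v v) = v"
    using linear_exists_left_inverse_on[OF lin S injS] by blast
  have Ag: "A *v g w = w" for w
    using surj g(3) by (metis UNIV_I imageE)
  have R: "matrix g *v w = g w" for w
    using g(2) by (simp add: matrix_works)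
  show ?thesis
  proof
    show "A ** matrix g = mat 1"
      by (simp add: matrix_eq R Ag flip: matrix_vector_mul_assoc)
    show "(matrix g *v w) $ i = 0" if "i \<notin> B" for w i
      using g(1) that by (auto simp: R S_def)
    show "matrix g *v (A *v v) = v" if "\<And>i. i \<notin> B \<Longrightarrow> v $ i = 0" for v
      using g(3) that by (simp add: R S_def)
  qed
qed

lemma nondegenerate_column_basis:
  assumes "nondegenerate A b x"
  shows "column_basis A (inactive_set x)"
proof -
  obtain B where B: "column_basis A B" "\<And>i. i \<notin> B \<Longrightarrow> x $ i = 0"
    using assms by (auto simp: nondegenerate_def basic_feasible_solution_def)
  have "inactive_set x \<subseteq> B"
    using B(2) by (force simp: inactive_set_def)
  moreover have "card (inactive_set x) = card B"
    using assms B(1) by (simp add: nondegenerate_def inactive_set_def column_basis_def)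
  ultimately have "inactive_set x = B"
    by (intro card_subset_eq) auto
  then show ?thesis using B(1) by simp
qed

text \<open>A kernel direction that decreases none of the zero components of \<open>x\<close> stays feasible for a short
  step. If the cost did not increase, the end point of a nonzero step would be a second solution.\<close>

lemma unique_solution_feasible_direction:
  fixes A :: "real^'n^'m"
  assumes sol: "primal_solution A b c x"
    and uniq: "\<forall>x'. primal_solution A b c x' \<longrightarrow> x' = x"
    and d: "A *v d = 0" "d \<noteq> 0" "\<And>i. x $ i = 0 \<Longrightarrow> 0 \<le> d $ i"
  shows "0 < c \<bullet> d"
proof (rule ccontr)
  assume neg: "\<not> 0 < c \<bullet> d"
  have x: "A *v x = b" "\<And>i. 0 \<le> x $ i"
    using sol by (auto simp: primal_solution_def primal_feasible_def less_eq_vec_def)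
  have ev: "\<forall>\<^sub>F t in at_right 0. 0 \<le> x $ i + t * d $ i" for i
  proof (cases "x $ i = 0")
    case True
    then show ?thesis
      using d(3)[of i] by (intro eventually_mono[OF eventually_at_right_less]) simp
  next
    case False
    then have "0 < x $ i" using x(2)[of i] by simp
    moreover have "((\<lambda>t. x $ i + t * d $ i) \<longlongrightarrow> x $ i + 0 * d $ i) (at_right 0)"
      by (intro tendsto_intros)
    ultimately have "\<forall>\<^sub>F t in at_right 0. 0 < x $ i + t * d $ i"
      by (intro order_tendstoD(1)) auto
    then show ?thesis by (rule eventually_mono) simp
  qed
  have "\<forall>\<^sub>F t::real in at_right 0. (\<forall>i. 0 \<le> x $ i + t * d $ i) \<and> 0 < t"
    by (intro eventually_conj eventually_all_finite ev eventually_at_right_less)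
  then obtain t where t: "\<And>i. 0 \<le> x $ i + t * d $ i" "0 < t"
    using eventually_happens[of _ "at_right (0::real)"] by auto
  have feas: "primal_feasible A b (x + t *\<^sub>R d)"
    using t(1) x(1) d(1)
    by (simp add: primal_feasible_def less_eq_vec_def matrix_vector_right_distrib
        matrix_vector_mult_scaleR)
  have "c \<bullet> (x + t *\<^sub>R d) \<le> c \<bullet> x"
    using neg t(2) by (simp add: inner_add_right mult_le_0_iff)
  then have "primal_solution A b c (x + t *\<^sub>R d)"
    using feas sol by (force simp: primal_solution_def)
  then have "x + t *\<^sub>R d = x" using uniq by blast
  then show False using t(2) d(2) by simp
qed

text \<open>The edge direction that lets the nonbasic variable \<open>j\<close> enter the basis is \<open>e\<^sub>j - R A e\<^sub>j\<close>. It
  lies in the kernel of \<open>A\<close>, its only nonzero component off the support of \<open>x\<close> is the \<open>j\<close>-th, which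
  is \<open>1\<close>, and its cost is the \<open>j\<close>-th reduced cost.\<close>

lemma unique_solution_reduced_cost_pos:
  fixes A :: "real^'n^'m" and R :: "real^'m^'n"
  assumes sol: "primal_solution A b c x"
    and uniq: "\<forall>x'. primal_solution A b c x' \<longrightarrow> x' = x"
    and AR: "A ** R = mat 1"
    and R: "\<And>w i. i \<notin> inactive_set x \<Longrightarrow> (R *v w) $ i = 0"
    and j: "j \<notin> inactive_set x"
  shows "0 < (c - transpose (R ** A) *v c) $ j"
proof -
  define d where "d = axis j 1 - R *v (A *v axis j 1)"
  have di: "d $ i = (if i = j then 1 else 0)" if "i \<notin> inactive_set x" for i
    using R[OF that] by (simp add: d_def axis_def)
  have "A *v d = 0"
    using AR by (simp add: d_def matrix_vector_mult_diff_distrib matrix_vector_mul_assoc)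
      (simp add: matrix_mul_assoc)
  moreover have "d \<noteq> 0"
    using di[OF j] by auto
  moreover have "0 \<le> d $ i" if "x $ i = 0" for i
    using that by (simp add: di inactive_set_def)
  ultimately have "0 < c \<bullet> d"
    by (rule unique_solution_feasible_direction[OF sol uniq])
  also have "c \<bullet> d = (c - transpose (R ** A) *v c) \<bullet> axis j 1"
    by (simp add: d_def inner_diff_left inner_diff_right dot_lmul_matrix matrix_vector_mul_assoc)
  finally show ?thesis
    by (simp add: inner_axis)
qed

theorem theorem3:
  fixes A :: "real^'n^'m" and b :: "real^'m" and c xstar :: "real^'n"
  assumes "CARD('m) \<le> CARD('n)"
    and "rank A = CARD('m)"
    and "primal_solution A b c xstar"
    and "\<forall>x. primal_solution A b c x \<longrightarrow> x = xstar"
    and "nondegenerate A b xstar"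
  shows "\<exists>lhat::real. lhat > 0 \<and>
    (\<forall>l::real^'n. 0 \<le> l \<and> norm l < lhat \<longrightarrow>
      (\<exists>x y s. strictly_complementary_solution A b c l x y s \<and>
        perturbed_active_set l x = active_set xstar \<and>
        perturbed_inactive_set l s = inactive_set xstar))"
proof -
  let ?B = "inactive_set xstar"
  obtain R :: "real^'m^'n" where AR: "A ** R = mat 1"
    and RN: "\<And>w i. i \<notin> ?B \<Longrightarrow> (R *v w) $ i = 0"
    and RA: "\<And>v. (\<And>i. i \<notin> ?B \<Longrightarrow> v $ i = 0) \<Longrightarrow> R *v (A *v v) = v"
    using column_basis_right_inverse[OF nondegenerate_column_basis[OF assms(5)]] by blast
  define P where "P = R ** A"
  define X where "X l = xstar + P *v l" for l
  define Z where "Z l = (c + l) - transpose P *v (c + l)" for l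
  have Ax: "A *v xstar = b" and x0: "\<And>i. 0 \<le> xstar $ i"
    using assms(3) by (auto simp: primal_solution_def primal_feasible_def less_eq_vec_def)
  have xN: "xstar $ i = 0" if "i \<notin> ?B" for i
    using that x0[of i] by (simp add: inactive_set_def)
  have AP: "A *v (P *v l) = A *v l" for l
    using AR by (simp add: P_def matrix_vector_mul_assoc) (simp add: matrix_mul_assoc)
  have XN: "X l $ i = 0" if "i \<notin> ?B" for i l
    using RN[OF that] xN[OF that] by (simp add: X_def P_def flip: matrix_vector_mul_assoc)
  have ZB: "Z l $ i = 0" if "i \<in> ?B" for i l
  proof -
    \<comment> \<open>\<open>P\<close> fixes the unit vectors of \<open>B\<close>, so its transpose preserves the components in \<open>B\<close>.\<close>
    have "P *v axis i 1 = axis i 1"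
      unfolding P_def matrix_vector_mul_assoc[symmetric]
      using that by (intro RA) (auto simp: axis_def)
    then have "(transpose P *v (c + l)) \<bullet> axis i 1 = (c + l) \<bullet> axis i 1"
      by (simp add: dot_lmul_matrix)
    then show ?thesis
      by (simp add: Z_def inner_axis)
  qed
  \<comment> \<open>At each index one of the two vectors vanishes for all \<open>l\<close>, so a positive sum makes the
    other one positive.\<close>
  have "\<forall>\<^sub>F l in nhds 0. 0 < X l $ i + Z l $ i" for i
  proof -
    have "0 < X 0 $ i + Z 0 $ i"
    proof (cases "i \<in> ?B")
      case True
      then show ?thesis using ZB[OF True, of 0] by (simp add: X_def inactive_set_def)
    next
      case False
      then show ?thesis
        using unique_solution_reduced_cost_pos[OF assms(3,4) AR RN False] XN[OF False, of 0]
        by (simp add: Z_def P_def)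
    qed
    moreover have "isCont (\<lambda>l. X l $ i + Z l $ i) 0"
      unfolding X_def Z_def matrix_vector_right_distrib
      by (intro continuous_intros matrix_vector_mul_linear linear_continuous_at
          linear_linear[THEN iffD2])
    then have "((\<lambda>l. X l $ i + Z l $ i) \<longlongrightarrow> X 0 $ i + Z 0 $ i) (nhds 0)"
      unfolding isCont_def by (rule tendsto_at_iff_tendsto_nhds[THEN iffD1])
    ultimately show ?thesis
      by (rule order_tendstoD(1)[rotated])
  qed
  then have "\<forall>\<^sub>F l in nhds 0. \<forall>i. 0 < X l $ i + Z l $ i"
    by (rule eventually_all_finite)
  then obtain r where r: "r > 0" "\<And>l i. norm l < r \<Longrightarrow> 0 < X l $ i + Z l $ i"
    by (auto simp: eventually_nhds_metric)
  have "\<exists>x y s. strictly_complementary_solution A b c l x y s \<and>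
      perturbed_active_set l x = active_set xstar \<and>
      perturbed_inactive_set l s = ?B" if "norm l < r" for l
  proof (intro exI conjI)
    let ?x = "X l - l" and ?s = "Z l - l" and ?y = "transpose R *v (c + l)"
    have pos: "0 < X l $ i + Z l $ i" for i
      using r(2)[OF that] .
    have XB: "0 < X l $ i" if "i \<in> ?B" for i
      using pos[of i] ZB[OF that] by simp
    have ZN: "0 < Z l $ i" if "i \<notin> ?B" for i
      using pos[of i] XN[OF that] by simp
    have X0: "0 \<le> X l $ i" and Z0: "0 \<le> Z l $ i" for i
      using XN[of i l] XB[of i] ZB[of i l] ZN[of i] by (cases "i \<in> ?B"; simp)+
    have "A *v ?x = b"
      by (simp add: X_def matrix_vector_mult_diff_distrib matrix_vector_right_distrib AP Ax)
    moreover have "transpose A *v ?y + ?s = c"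
      by (simp only: Z_def P_def matrix_transpose_mul matrix_vector_mul_assoc) simp
    moreover have "(?x $ i + l $ i) * (?s $ i + l $ i) = 0" for i
      using XN[of i] ZB[of i] by auto
    ultimately show "strictly_complementary_solution A b c l ?x ?y ?s"
      using pos X0 Z0 by (simp add: strictly_complementary_solution_def perturbed_solution_def
          less_eq_vec_def)
    show "perturbed_active_set l ?x = active_set xstar"
    proof -
      have "X l $ i = 0 \<longleftrightarrow> xstar $ i = 0" for i
        using XN[of i l] XB[of i] xN[of i] by (cases "i \<in> ?B") (auto simp: inactive_set_def)
      then show ?thesis
        by (simp add: perturbed_active_set_def active_set_def)
    qed
    show "perturbed_inactive_set l ?s = ?B"
    proof -
      have "Z l $ i = 0 \<longleftrightarrow> i \<in> ?B" for i
        using ZB[of i l] ZN[of i] by (cases "i \<in> ?B") auto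
      then show ?thesis
        by (simp add: perturbed_inactive_set_def)
    qed
  qed
  then show ?thesis
    using r(1) by blast
qed

end
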